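(* There are no rational points $\mathfrak{p}\in\mathcal{L}_2$ with weighted height $\mathfrak{H}(\mathfrak{p})<\tfrac32$.
   Context: Weights: $\mathfrak{w}=(q_0,q_1,q_2,q_3)=(2,4,6,10)$. Two nonzero tuples are equivalent if they differ by the action $\lambda\star(x_0,x_1,x_2,x_3)=(\lambda^{2}x_0,\lambda^{4}x_1,\lambda^{6}x_2,\lambda^{10}x_3)$ with $\lambda\in\mathbb{C}^*$; the classes form the weighted projective space $\mathbb{P}_{(2,4,6,10)}$. A rational point is a class that has a representative with coordinates in $\mathbb{Q}$ (equivalently, in $\mathbb{Z}$). Weighted height: for a rational point $\mathfrak{p}$, $\mathfrak{H}(\mathfrak{p})=\max_i |x_i|^{1/q_i}$, where $(x_0,x_1,x_2,x_3)$ is a normalized (reduced) integer representative of $\mathfrak{p}$; that is, $\mathfrak{H}(\mathfrak{p})$ is the smallest value of $\max_i|x_i|^{1/q_i}$ over all integer representatives $(x_0,\dots,x_3)$ of $\mathfrak{p}$. The moduli space $\mathcal{M}_2$ of genus 2 curves is identified with the set of points $[J_2:J_4:J_6:J_{10}]$ of $\mathbb{P}_{(2,4,6,10)}$ with $J_{10}\ne 0$. $\mathcal{L}_2\subset\mathcal{M}_2$ (the locus of genus 2 curves with extra automorphisms, equivalently with $(2,2)$-split Jacobian) is the set of points $\mathfrak{p}=[J_2:J_4:J_6:J_{10}]$ with $J_{10}\neq 0$ and $J_{30}(\mathfrak{p})=0$, where $$\begin{aligned} J_{30}={}&41472 J_{10} J_4^5+159 J_4^6 J_2^3-236196 J_{10}^2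 J_2^5-80 J_4^7 J_2+104976000 J_{10}^2 J_2^2 J_6-1728 J_4^5 J_2^2 J_6\\ &+6048 J_4^4 J_2 J_6^2-9331200 J_{10} J_4^2 J_6^2-2099520000 J_{10}^2 J_4 J_6+12 J_2^6 J_4^3 J_6-54 J_2^5 J_4^2 J_6^2\\ &+108 J_2^4 J_4 J_6^3+1332 J_2^4 J_4^4 J_6-8910 J_2^3 J_4^3 J_6^2+29376 J_2^2 J_4^2 J_6^3-47952 J_2 J_4 J_6^4-J_2^7 J_4^4\\ &-81 J_2^3 J_6^4-78 J_2^5 J_4^5+384 J_4^6 J_6-6912 J_4^3 J_6^3+507384000 J_{10}^2 J_4^2 J_2-19245600 J_{10}^2 J_4 J_2^3\\ &-592272 J_{10} J_4^4 J_2^2+77436 J_{10} J_4^3 J_2^4+4743360 J_{10} J_4^3 J_2 J_6-870912 J_{10} J_4^2 J_2^3 J_6\\ &+3090960 J_{10} J_4 J_2^2 J_6^2-5832 J_{10} J_2^5 J_4 J_6-125971200000 J_{10}^3+31104 J_6^5+972 J_{10} J_2^6 J_4^2\\ &+8748 J_{10} J_2^4 J_6^2-3499200 J_{10} J_2 J_6^3 . \end{aligned}$$ *)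

theory Defs
  imports Complex_Main
begin

type_synonym wtuple = "complex \<times> complex \<times> complex \<times> complex"

definition wact :: "complex \<Rightarrow> wtuple \<Rightarrow> wtuple" where
  "wact l = (\<lambda>(x0, x1, x2, x3). (l^2 * x0, l^4 * x1, l^6 * x2, l^10 * x3))"

definition nonzero_tuples :: "wtuple set" where
  "nonzero_tuples = UNIV - {(0, 0, 0, 0)}"

definition wrel :: "(wtuple \<times> wtuple) set" where
  "wrel = {(x, y). x \<in> nonzero_tuples \<and> y \<in> nonzero_tuples \<and> (\<exists>l. l \<noteq> 0 \<and> y = wact l x)}"

definition wproj_space :: "wtuple set set" where
  "wproj_space = nonzero_tuples // wrel"

definition wpoint :: "complex \<Rightarrow> complex \<Rightarrow> complex \<Rightarrow> complex \<Rightarrow> wtuple set" where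
  "wpoint x0 x1 x2 x3 = wrel `` {(x0, x1, x2, x3)}"

lemma wact_one: "wact 1 x = x"
  by (cases x) (simp add: wact_def)

lemma wact_wact: "wact k (wact l x) = wact (k * l) x"
  by (cases x) (simp add: wact_def power_mult_distrib mult.assoc)

lemma wrelI:
  assumes "x \<in> nonzero_tuples" "y \<in> nonzero_tuples" "l \<noteq> 0" "y = wact l x"
  shows "(x, y) \<in> wrel"
  unfolding wrel_def using assms by blast

lemma wrelE:
  assumes "(x, y) \<in> wrel"
  obtains l where "x \<in> nonzero_tuples" "y \<in> nonzero_tuples" "l \<noteq> 0" "y = wact l x"
  using assms unfolding wrel_def by blast

lemma equiv_wrel: "equiv nonzero_tuples wrel"
proof (rule equivI)
  show "wrel \<subseteq> nonzero_tuples \<times> nonzero_tuples"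
    unfolding wrel_def by blast
  show "refl_on nonzero_tuples wrel"
    by (intro refl_onI wrelI[where l = 1]) (simp_all add: wact_one)
  show "sym wrel"
  proof (rule symI)
    fix x y assume "(x, y) \<in> wrel"
    then obtain l where l: "x \<in> nonzero_tuples" "y \<in> nonzero_tuples" "l \<noteq> 0" "y = wact l x"
      by (rule wrelE)
    have "wact (inverse l) y = x"
      unfolding l(4) wact_wact using l(3) by (simp add: wact_one)
    with l show "(y, x) \<in> wrel"
      by (intro wrelI[where l = "inverse l"]) simp_all
  qed
  show "trans wrel"
  proof (rule transI)
    fix x y z assume xy: "(x, y) \<in> wrel" and yz: "(y, z) \<in> wrel"
    obtain l where l: "x \<in> nonzero_tuples" "l \<noteq> 0" "y = wact l x"
      using xy by (rule wrelE)
    obtain k where k: "z \<in> nonzero_tuples" "k \<noteq> 0" "z = wact k y"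
      using yz by (rule wrelE)
    have "z = wact (k * l) x"
      unfolding k(3) l(3) by (rule wact_wact)
    with l k show "(x, z) \<in> wrel"
      by (intro wrelI[where l = "k * l"]) simp_all
  qed
qed

definition rational_point :: "wtuple set \<Rightarrow> bool" where
  "rational_point p \<longleftrightarrow> p \<in> wproj_space \<and>
     (\<exists>x0 x1 x2 x3. (x0, x1, x2, x3) \<in> p \<and> x0 \<in> \<rat> \<and> x1 \<in> \<rat> \<and> x2 \<in> \<rat> \<and> x3 \<in> \<rat>)"

definition integer_reps :: "wtuple set \<Rightarrow> (int \<times> int \<times> int \<times> int) set" where
  "integer_reps p = {(a0, a1, a2, a3). (of_int a0, of_int a1, of_int a2, of_int a3) \<in> p}"

definition tuple_height :: "int \<times> int \<times> int \<times> int \<Rightarrow> real" where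
  "tuple_height = (\<lambda>(a0, a1, a2, a3).
     Max {root 2 (real_of_int \<bar>a0\<bar>), root 4 (real_of_int \<bar>a1\<bar>),
          root 6 (real_of_int \<bar>a2\<bar>), root 10 (real_of_int \<bar>a3\<bar>)})"

text \<open>On rational points the infimum is a minimum; see \<open>weighted_height_attained\<close> below.\<close>

definition weighted_height :: "wtuple set \<Rightarrow> real" where
  "weighted_height p = Inf (tuple_height ` integer_reps p)"

lemma rational_point_integer_reps:
  assumes "rational_point p"
  shows "integer_reps p \<noteq> {}"
proof -
  obtain x0 x1 x2 x3 where p: "p \<in> wproj_space" and x: "(x0, x1, x2, x3) \<in> p"
    and rat: "x0 \<in> \<rat>" "x1 \<in> \<rat>" "x2 \<in> \<rat>" "x3 \<in> \<rat>"
    using assms unfolding rational_point_def by blast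
  have clear: "\<exists>d a. d \<noteq> (0::int) \<and> of_int d * z = (of_int a :: complex)" if "z \<in> \<rat>" for z
  proof -
    obtain a b :: int where "b \<noteq> 0" "z = of_int a / of_int b"
      using \<open>z \<in> \<rat>\<close> by (metis Rats_cases' less_irrefl)
    then show ?thesis
      by (intro exI[of _ b] exI[of _ a]) simp
  qed
  obtain d0 a0 where 0: "d0 \<noteq> (0::int)" "of_int d0 * x0 = of_int a0" using clear[OF rat(1)] by blast
  obtain d1 a1 where 1: "d1 \<noteq> (0::int)" "of_int d1 * x1 = of_int a1" using clear[OF rat(2)] by blast
  obtain d2 a2 where 2: "d2 \<noteq> (0::int)" "of_int d2 * x2 = of_int a2" using clear[OF rat(3)] by blast
  obtain d3 a3 where 3: "d3 \<noteq> (0::int)" "of_int d3 * x3 = of_int a3" using clear[OF rat(4)] by blast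
  define l where "l = d0 * d1 * d2 * d3"
  have l: "l \<noteq> 0" using 0 1 2 3 by (simp add: l_def)
  have scale: "\<exists>b. (of_int l)^n * z = (of_int b :: complex)"
    if "n > 0" "l = d * e" "of_int d * z = of_int a" for n d e a z
  proof
    have "(of_int l)^n * z = (of_int l)^(n - 1) * of_int l * z"
      using that(1) by (simp add: power_eq_if)
    also have "\<dots> = (of_int l)^(n - 1) * of_int e * (of_int d * z)"
      unfolding that(2) of_int_mult by (simp only: mult_ac)
    also have "\<dots> = of_int (l^(n - 1) * e * a)"
      unfolding that(3) by simp
    finally show "(of_int l)^n * z = of_int (l^(n - 1) * e * a)" .
  qed
  have "\<exists>b. (of_int l)^2 * x0 = (of_int b :: complex)"
    using 0 by (intro scale[of 2 d0 "d1 * d2 * d3"]) (auto simp: l_def)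
  moreover have "\<exists>b. (of_int l)^4 * x1 = (of_int b :: complex)"
    using 1 by (intro scale[of 4 d1 "d0 * d2 * d3"]) (auto simp: l_def)
  moreover have "\<exists>b. (of_int l)^6 * x2 = (of_int b :: complex)"
    using 2 by (intro scale[of 6 d2 "d0 * d1 * d3"]) (auto simp: l_def)
  moreover have "\<exists>b. (of_int l)^10 * x3 = (of_int b :: complex)"
    using 3 by (intro scale[of 10 d3 "d0 * d1 * d2"]) (auto simp: l_def)
  ultimately obtain b0 b1 b2 b3 where b:
    "wact (of_int l) (x0, x1, x2, x3) = (of_int b0, of_int b1, of_int b2, of_int b3)"
    by (auto simp: wact_def)
  have nz: "(x0, x1, x2, x3) \<in> nonzero_tuples"
    using p x equiv_wrel by (metis in_quotient_imp_subset subsetD wproj_space_def)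
  have "((x0, x1, x2, x3), wact (of_int l) (x0, x1, x2, x3)) \<in> wrel"
  proof -
    have "wact (of_int l) (x0, x1, x2, x3) \<in> nonzero_tuples"
      using nz l by (auto simp: nonzero_tuples_def wact_def)
    moreover have "(of_int l :: complex) \<noteq> 0"
      using l by simp
    ultimately show ?thesis
      using nz unfolding wrel_def by blast
  qed
  then have "wact (of_int l) (x0, x1, x2, x3) \<in> p"
    using p x equiv_wrel by (metis in_quotient_imp_closed wproj_space_def)
  then have "(b0, b1, b2, b3) \<in> integer_reps p"
    using b by (simp add: integer_reps_def)
  then show ?thesis by blast
qed

lemma finite_tuple_height_le: "finite {a. tuple_height a \<le> B}"
proof -
  define N where "N = \<lceil>\<bar>B\<bar>^2 + \<bar>B\<bar>^4 + \<bar>B\<bar>^6 + \<bar>B\<bar>^10\<rceil>"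
  have bound: "\<bar>a\<bar> \<le> N" if "root n (real_of_int \<bar>a\<bar>) \<le> B" "n \<in> {2, 4, 6, 10}" for n and a :: int
  proof -
    have n: "n > 0" using that(2) by auto
    have "real_of_int \<bar>a\<bar> = root n (real_of_int \<bar>a\<bar>) ^ n"
      using n by (simp add: real_root_pow_pos2)
    also have "\<dots> \<le> \<bar>B\<bar> ^ n"
      using that(1) n by (intro power_mono) auto
    also have "\<dots> \<le> \<bar>B\<bar>^2 + \<bar>B\<bar>^4 + \<bar>B\<bar>^6 + \<bar>B\<bar>^10"
      using that(2) by auto
    finally show ?thesis
      unfolding N_def by linarith
  qed
  have "{a. tuple_height a \<le> B} \<subseteq> {-N..N} \<times> {-N..N} \<times> {-N..N} \<times> {-N..N}"
  proof
    fix a assume "a \<in> {a. tuple_height a \<le> B}"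
    then obtain a0 a1 a2 a3 where a: "a = (a0, a1, a2, a3)" and
      "root 2 (real_of_int \<bar>a0\<bar>) \<le> B" "root 4 (real_of_int \<bar>a1\<bar>) \<le> B"
      "root 6 (real_of_int \<bar>a2\<bar>) \<le> B" "root 10 (real_of_int \<bar>a3\<bar>) \<le> B"
      by (cases a) (auto simp: tuple_height_def)
    then have "\<bar>a0\<bar> \<le> N" "\<bar>a1\<bar> \<le> N" "\<bar>a2\<bar> \<le> N" "\<bar>a3\<bar> \<le> N"
      by (auto intro: bound)
    then show "a \<in> {-N..N} \<times> {-N..N} \<times> {-N..N} \<times> {-N..N}"
      using a by auto
  qed
  then show ?thesis
    by (rule finite_subset) simp
qed

lemma weighted_height_attained:
  assumes "rational_point p"
  shows "\<exists>a \<in> integer_reps p. tuple_height a = weighted_height p \<and>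
           (\<forall>b \<in> integer_reps p. tuple_height a \<le> tuple_height b)"
proof -
  obtain c where c: "c \<in> integer_reps p"
    using rational_point_integer_reps[OF assms] by blast
  define S where "S = integer_reps p \<inter> {a. tuple_height a \<le> tuple_height c}"
  have S: "finite S" "c \<in> S"
    using c finite_tuple_height_le by (auto simp: S_def)
  define a where "a = arg_min_on tuple_height S"
  have a: "a \<in> S" "\<forall>b \<in> S. tuple_height a \<le> tuple_height b"
    using S arg_min_if_finite[of S tuple_height] by (fastforce simp: a_def not_less)+
  have least: "\<forall>b \<in> integer_reps p. tuple_height a \<le> tuple_height b"
  proof
    fix b assume b: "b \<in> integer_reps p"
    show "tuple_height a \<le> tuple_height b"
      using a b S(2) by (cases "tuple_height b \<le> tuple_height c") (fastforce simp: S_def)+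
  qed
  have "weighted_height p = tuple_height a"
    unfolding weighted_height_def using a(1) least
    by (intro cInf_eq_minimum) (auto simp: S_def)
  with a(1) least show ?thesis
    by (auto simp: S_def)
qed

definition J30 :: "complex \<Rightarrow> complex \<Rightarrow> complex \<Rightarrow> complex \<Rightarrow> complex" where
  "J30 J2 J4 J6 J10 =
      41472 * J10 * J4^5 + 159 * J4^6 * J2^3 - 236196 * J10^2 * J2^5 - 80 * J4^7 * J2 + 104976000 * J10^2 * J2^2 * J6 - 1728 * J4^5 * J2^2 * J6
      + 6048 * J4^4 * J2 * J6^2 - 9331200 * J10 * J4^2 * J6^2 - 2099520000 * J10^2 * J4 * J6 + 12 * J2^6 * J4^3 * J6 - 54 * J2^5 * J4^2 * J6^2
      + 108 * J2^4 * J4 * J6^3 + 1332 * J2^4 * J4^4 * J6 - 8910 * J2^3 * J4^3 * J6^2 + 29376 * J2^2 * J4^2 * J6^3 - 47952 * J2 * J4 * J6^4 - J2^7 * J4^4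
      - 81 * J2^3 * J6^4 - 78 * J2^5 * J4^5 + 384 * J4^6 * J6 - 6912 * J4^3 * J6^3 + 507384000 * J10^2 * J4^2 * J2 - 19245600 * J10^2 * J4 * J2^3
      - 592272 * J10 * J4^4 * J2^2 + 77436 * J10 * J4^3 * J2^4 + 4743360 * J10 * J4^3 * J2 * J6 - 870912 * J10 * J4^2 * J2^3 * J6
      + 3090960 * J10 * J4 * J2^2 * J6^2 - 5832 * J10 * J2^5 * J4 * J6 - 125971200000 * J10^3 + 31104 * J6^5 + 972 * J10 * J2^6 * J4^2
      + 8748 * J10 * J2^4 * J6^2 - 3499200 * J10 * J2 * J6^3"

definition moduli_M2 :: "wtuple set set" where
  "moduli_M2 = {wpoint J2 J4 J6 J10 | J2 J4 J6 J10. J10 \<noteq> 0}"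

definition locus_L2 :: "wtuple set set" where
  "locus_L2 = {wpoint J2 J4 J6 J10 | J2 J4 J6 J10. J10 \<noteq> 0 \<and> J30 J2 J4 J6 J10 = 0}"

text \<open>By homogeneity the vanishing of \<open>J30\<close> does not depend on the representative.\<close>

lemma J30_homogeneous:
  "J30 (l^2 * J2) (l^4 * J4) (l^6 * J6) (l^10 * J10) = l^30 * J30 J2 J4 J6 J10"
  unfolding J30_def by (simp add: algebra_simps power_numeral_reduce)

lemma locus_L2_subset: "locus_L2 \<subseteq> moduli_M2"
  by (auto simp: locus_L2_def moduli_M2_def)

lemma wpoint_in_locus_L2_iff:
  "wpoint J2 J4 J6 J10 \<in> locus_L2 \<longleftrightarrow> J10 \<noteq> 0 \<and> J30 J2 J4 J6 J10 = 0"
proof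
  assume "wpoint J2 J4 J6 J10 \<in> locus_L2"
  then obtain K2 K4 K6 K10 where K: "wpoint J2 J4 J6 J10 = wpoint K2 K4 K6 K10"
    "K10 \<noteq> 0" "J30 K2 K4 K6 K10 = 0"
    by (auto simp: locus_L2_def)
  have "(K2, K4, K6, K10) \<in> wpoint K2 K4 K6 K10"
    unfolding wpoint_def using K(2)
    by (intro equiv_class_self[OF equiv_wrel]) (simp add: nonzero_tuples_def)
  then have "((J2, J4, J6, J10), (K2, K4, K6, K10)) \<in> wrel"
    using K(1) unfolding wpoint_def by blast
  then obtain l where "l \<noteq> 0" "K2 = l^2 * J2" "K4 = l^4 * J4" "K6 = l^6 * J6" "K10 = l^10 * J10"
    by (auto simp: wrel_def wact_def)
  with K(2,3) show "J10 \<noteq> 0 \<and> J30 J2 J4 J6 J10 = 0"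
    by (simp add: J30_homogeneous)
qed (auto simp: locus_L2_def)

end

theory Submission
  imports Defs
begin

text \<open>
  A point of height below \<open>3/2\<close> has an integer representative with \<open>\<bar>J2\<bar> \<le> 2\<close>,
  \<open>\<bar>J4\<bar> \<le> 5\<close> and \<open>\<bar>J6\<bar> \<le> 11\<close>.  For \<open>(J2, J4, J6)\<close> in this box the monomial
  \<open>-125971200000 * J10^3\<close> is so large that it decides the sign of \<open>J30\<close> at every nonzero
  integer \<open>J10\<close>, so \<open>J30\<close> cannot vanish.

  In detail, the action of \<open>\<lambda> = \<i>\<close> is \<open>(J2, J4, J6, J10) \<mapsto> (-J2, J4, -J6, -J10)\<close>; it
  preserves the box and changes the sign of \<open>J30\<close>, so \<open>J10 \<ge> 1\<close> may be assumed.  For fixed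
  \<open>J2, J4, J6\<close> regard \<open>J30\<close> as a cubic in \<open>J10\<close> and expand it in powers of \<open>J10 - 1\<close>.  All
  coefficients of this expansion are negative (lemma \<open>taylor_coeffs_negative\<close>), hence \<open>J30 < 0\<close>
  for all \<open>J10 \<ge> 1\<close> (lemma \<open>J30_int_negative\<close>).

  The coefficients of positive degree are negative already by the triangle inequality.  The
  constant coefficient, the value at \<open>J10 = 1\<close>, is more delicate, because
  \<open>2099520000 * J4 * J6\<close> can come close to \<open>125971200000\<close> in absolute value.  Its sign is read off
  at each of the finitely many integer points of the box, and the same evaluation covers the
  other coefficients.
\<close>

definition J30_coeff0 :: "int \<Rightarrow> int \<Rightarrow> int \<Rightarrow> int" where
  "J30_coeff0 x y z =
     159 * y^6 * x^3 - 80 * y^7 * x - 1728 * y^5 * x^2 * z + 6048 * y^4 * x * z^2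
     + 12 * x^6 * y^3 * z - 54 * x^5 * y^2 * z^2 + 108 * x^4 * y * z^3 + 1332 * x^4 * y^4 * z
     - 8910 * x^3 * y^3 * z^2 + 29376 * x^2 * y^2 * z^3 - 47952 * x * y * z^4 - x^7 * y^4
     - 81 * x^3 * z^4 - 78 * x^5 * y^5 + 384 * y^6 * z - 6912 * y^3 * z^3 + 31104 * z^5"

definition J30_coeff1 :: "int \<Rightarrow> int \<Rightarrow> int \<Rightarrow> int" where
  "J30_coeff1 x y z =
     41472 * y^5 - 9331200 * y^2 * z^2 - 592272 * y^4 * x^2 + 77436 * y^3 * x^4
     + 4743360 * y^3 * x * z - 870912 * y^2 * x^3 * z + 3090960 * y * x^2 * z^2
     - 5832 * x^5 * y * z + 972 * x^6 * y^2 + 8748 * x^4 * z^2 - 3499200 * x * z^3"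

definition J30_coeff2 :: "int \<Rightarrow> int \<Rightarrow> int \<Rightarrow> int" where
  "J30_coeff2 x y z =
     104976000 * x^2 * z - 236196 * x^5 - 2099520000 * y * z + 507384000 * y^2 * x
     - 19245600 * y * x^3"

definition J30_int :: "int \<Rightarrow> int \<Rightarrow> int \<Rightarrow> int \<Rightarrow> int" where
  "J30_int x y z w =
     J30_coeff0 x y z + J30_coeff1 x y z * w + J30_coeff2 x y z * w^2 - 125971200000 * w^3"

lemma J30_of_int:
  "J30 (of_int x) (of_int y) (of_int z) (of_int w) = of_int (J30_int x y z w)"
  unfolding J30_def J30_int_def J30_coeff0_def J30_coeff1_def J30_coeff2_def
  by (simp add: algebra_simps)

lemma J30_int_uminus: "J30_int (- x) y (- z) (- w) = - J30_int x y z w"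
  by (simp add: J30_int_def J30_coeff0_def J30_coeff1_def J30_coeff2_def algebra_simps)

text \<open>
  The three quantities are the value, the first derivative and half the second derivative of
  the cubic \<open>J30_int x y z\<close> at \<open>1\<close>.
\<close>

lemma taylor_coeffs_negative:
  assumes "\<bar>x\<bar> \<le> 2" "\<bar>y\<bar> \<le> 5" "\<bar>z\<bar> \<le> 11"
  shows "J30_coeff0 x y z + J30_coeff1 x y z + J30_coeff2 x y z - 125971200000 < 0"
    and "J30_coeff1 x y z + 2 * J30_coeff2 x y z - 3 * 125971200000 < 0"
    and "J30_coeff2 x y z - 3 * 125971200000 < 0"
proof -
  have "list_all (\<lambda>x. list_all (\<lambda>y. list_all (\<lambda>z.
          J30_coeff0 x y z + J30_coeff1 x y z + J30_coeff2 x y z - 125971200000 < 0 \<and>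
          J30_coeff1 x y z + 2 * J30_coeff2 x y z - 3 * 125971200000 < 0 \<and>
          J30_coeff2 x y z - 3 * 125971200000 < 0) [-11..11]) [-5..5]) [-2..2]"
    by code_simp
  moreover have "x \<in> set [-2..2]" "y \<in> set [-5..5]" "z \<in> set [-11..11]"
    using assms unfolding set_upto atLeastAtMost_iff by linarith+
  ultimately show "J30_coeff0 x y z + J30_coeff1 x y z + J30_coeff2 x y z - 125971200000 < 0"
    and "J30_coeff1 x y z + 2 * J30_coeff2 x y z - 3 * 125971200000 < 0"
    and "J30_coeff2 x y z - 3 * 125971200000 < 0"
    unfolding list_all_iff by blast+
qed

lemma J30_int_negative:
  assumes "\<bar>x\<bar> \<le> 2" "\<bar>y\<bar> \<le> 5" "\<bar>z\<bar> \<le> 11" and "w \<ge> 1"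
  shows "J30_int x y z w < 0"
proof -
  note neg = taylor_coeffs_negative[OF assms(1-3)]
  define t where "t = w - 1"
  have t: "t \<ge> 0" "w = 1 + t"
    using assms(4) by (auto simp: t_def)
  have "J30_int x y z w =
          (J30_coeff0 x y z + J30_coeff1 x y z + J30_coeff2 x y z - 125971200000)
          + (J30_coeff1 x y z + 2 * J30_coeff2 x y z - 3 * 125971200000) * t
          + (J30_coeff2 x y z - 3 * 125971200000) * t^2 - 125971200000 * t^3"
    unfolding J30_int_def t(2) by (simp add: algebra_simps power2_eq_square power3_eq_cube)
  moreover have "(J30_coeff1 x y z + 2 * J30_coeff2 x y z - 3 * 125971200000) * t \<le> 0"
    using neg(2) t(1) by (intro mult_nonpos_nonneg) auto
  moreover have "(J30_coeff2 x y z - 3 * 125971200000) * t^2 \<le> 0"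
    using neg(3) by (intro mult_nonpos_nonneg) auto
  moreover have "t^3 \<ge> 0"
    using t(1) by simp
  ultimately show ?thesis
    using neg(1) by linarith
qed

lemma J30_int_nonzero:
  assumes "\<bar>x\<bar> \<le> 2" "\<bar>y\<bar> \<le> 5" "\<bar>z\<bar> \<le> 11" and "w \<noteq> 0"
  shows "J30_int x y z w \<noteq> 0"
proof (cases "w \<ge> 1")
  case True
  then show ?thesis
    using J30_int_negative[OF assms(1-3), of w] by simp
next
  case False
  then have "J30_int (- x) y (- z) (- w) < 0"
    using assms by (intro J30_int_negative) auto
  then show ?thesis
    by (simp add: J30_int_uminus)
qed

text \<open>The box arises since \<open>(3/2)^2 < 3\<close>, \<open>(3/2)^4 < 6\<close> and \<open>(3/2)^6 < 12\<close>.\<close>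

lemma tuple_height_less_three_halves:
  assumes "tuple_height (x, y, z, w) < 3 / 2"
  shows "\<bar>x\<bar> \<le> 2" "\<bar>y\<bar> \<le> 5" "\<bar>z\<bar> \<le> 11"
proof -
  have bound: "real_of_int \<bar>a\<bar> < (3 / 2) ^ n" if "root n (real_of_int \<bar>a\<bar>) < 3 / 2" "n > 0" for n a
  proof -
    have "real_of_int \<bar>a\<bar> = root n (real_of_int \<bar>a\<bar>) ^ n"
      using that(2) by (simp add: real_root_pow_pos2)
    also have "\<dots> < (3 / 2) ^ n"
      using that by (intro power_strict_mono) auto
    finally show ?thesis .
  qed
  have "root 2 (real_of_int \<bar>x\<bar>) < 3 / 2" "root 4 (real_of_int \<bar>y\<bar>) < 3 / 2"
    "root 6 (real_of_int \<bar>z\<bar>) < 3 / 2"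
    using assms unfolding tuple_height_def prod.case by (subst (asm) Max_less_iff; simp)+
  from this[THEN bound] show "\<bar>x\<bar> \<le> 2" "\<bar>y\<bar> \<le> 5" "\<bar>z\<bar> \<le> 11"
    by (simp_all add: power_numeral_reduce)
qed

lemma J30_zero_on_locus_L2:
  assumes "p \<in> locus_L2" "(x, y, z, w) \<in> p"
  shows "w \<noteq> 0" "J30 x y z w = 0"
proof -
  obtain J2 J4 J6 J10 where J: "p = wpoint J2 J4 J6 J10" "J10 \<noteq> 0" "J30 J2 J4 J6 J10 = 0"
    using assms(1) by (auto simp: locus_L2_def)
  then have "((J2, J4, J6, J10), (x, y, z, w)) \<in> wrel"
    using assms(2) by (simp add: wpoint_def)
  then obtain l where "l \<noteq> 0" "(x, y, z, w) = wact l (J2, J4, J6, J10)"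
    by (auto elim: wrelE)
  then show "w \<noteq> 0" "J30 x y z w = 0"
    using J(2,3) by (simp_all add: wact_def J30_homogeneous)
qed

theorem lemma7:
  shows "\<not> (\<exists>p \<in> locus_L2. rational_point p \<and> weighted_height p < 3 / 2)"
proof
  assume "\<exists>p \<in> locus_L2. rational_point p \<and> weighted_height p < 3 / 2"
  then obtain p where p: "p \<in> locus_L2" "rational_point p" "weighted_height p < 3 / 2"
    by blast
  then obtain x y z w where rep: "(x, y, z, w) \<in> integer_reps p"
    and "tuple_height (x, y, z, w) < 3 / 2"
    using weighted_height_attained[OF p(2)] by (metis prod_cases4)
  then have box: "\<bar>x\<bar> \<le> 2" "\<bar>y\<bar> \<le> 5" "\<bar>z\<bar> \<le> 11"
    using tuple_height_less_three_halves by blast+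
  have "(of_int x, of_int y, of_int z, of_int w) \<in> p"
    using rep by (simp add: integer_reps_def)
  from J30_zero_on_locus_L2[OF p(1) this] have "w \<noteq> 0" "J30_int x y z w = 0"
    by (simp_all add: J30_of_int)
  then show False
    using J30_int_nonzero[OF box] by blast
qed

end
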